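(* Let $J$ be a positive integer, let $\lambda_0,\ldots,\lambda_{J-1}>0$ and $\mu_1,\ldots,\mu_J>0$ be real numbers, and set $\lambda_J=0$ and $r_i=\lambda_i+\mu_i$ for $i=1,\ldots,J$. Let $\mathbf{W}=(w_{ij})_{i,j=1}^J$ be the $J\times J$ tridiagonal matrix with $$w_{ii}=r_i\ (1\le i\le J),\qquad w_{i,i+1}=-\lambda_i\ (1\le i\le J-1),\qquad w_{i,i-1}=-\mu_i\ (2\le i\le J),$$ and all other entries $0$. Then $\mathbf{W}$ is non-singular and the elements of its inverse are $$\big(\mathbf{W}^{-1}\big)_{ij}=\sum_{k=1}^{\min\{i,j\}}\frac{\pi_j}{\pi_k\mu_k},\qquad i,j=1,\ldots,J,$$ where $$\pi_i=\frac{\prod_{k=1}^i(\lambda_{k-1}/\mu_k)}{\sum_{j=0}^J\prod_{k=1}^j(\lambda_{k-1}/\mu_k)},\qquad i=0,1,\ldots,J.$$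
   Context: Empty products equal $1$. The numbers $\pi_i$ are the stationary probabilities of the birth--death Markov chain on $\{0,1,\ldots,J\}$ with birth rates $\lambda_i$ and death rates $\mu_i$ (with $\lambda_J=\mu_0=0$). *)

theory Defs
  imports Complex_Main "Jordan_Normal_Form.Matrix"
begin

text \<open>
  Rates are functions on \<open>nat\<close>; only \<open>lam 0, \<dots>, lam J\<close> and \<open>mu 1, \<dots>, mu J\<close> are ever used.
\<close>

definition rate_prod :: "(nat \<Rightarrow> real) \<Rightarrow> (nat \<Rightarrow> real) \<Rightarrow> nat \<Rightarrow> real" where
  "rate_prod lam mu i = (\<Prod>k=1..i. lam (k - 1) / mu k)"

definition stat_prob :: "nat \<Rightarrow> (nat \<Rightarrow> real) \<Rightarrow> (nat \<Rightarrow> real) \<Rightarrow> nat \<Rightarrow> real" where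
  "stat_prob J lam mu i = rate_prod lam mu i / (\<Sum>j=0..J. rate_prod lam mu j)"

text \<open>
  Library matrices are indexed from \<open>0\<close>: the entry \<open>w\<^sub>i\<^sub>j\<close> with \<open>i, j \<in> {1..J}\<close>
  is found at position \<open>(i - 1, j - 1)\<close>.
\<close>

definition tridiag_entry :: "(nat \<Rightarrow> real) \<Rightarrow> (nat \<Rightarrow> real) \<Rightarrow> nat \<Rightarrow> nat \<Rightarrow> real" where
  "tridiag_entry lam mu i j =
     (if j = i then lam i + mu i
      else if j = i + 1 then - lam i
      else if i = j + 1 then - mu i
      else 0)"

definition W_mat :: "nat \<Rightarrow> (nat \<Rightarrow> real) \<Rightarrow> (nat \<Rightarrow> real) \<Rightarrow> real mat" where
  "W_mat J lam mu = mat J J (\<lambda>(a, b). tridiag_entry lam mu (a + 1) (b + 1))"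

end

theory Submission
  imports Defs "Jordan_Normal_Form.Determinant"
begin

text \<open>
  The matrix \<open>W\<close> is minus the generator of the birth--death chain killed on its entry to \<open>0\<close>, so
  in terms of backward increments \<open>\<Delta>g(i) = g(i) - g(i - 1)\<close> it is a first-order operator: for a
  vector \<open>g\<close> extended by \<open>g(0) = 0\<close>,
  \<open>(W g)(i) = \<mu>\<^sub>i \<Delta>g(i) - \<lambda>\<^sub>i \<Delta>g(i + 1)\<close>
  (\<open>tridiag_row_sum\<close>). The boundary value \<open>g(0) = 0\<close> accounts for the missing subdiagonal entry of
  the first row, and \<open>\<lambda>\<^sub>J = 0\<close> for the missing superdiagonal entry of the last.

  The \<open>j\<close>-th column of the claimed inverse is written as a sum of its increments, which are
  \<open>\<pi>\<^sub>j / (\<pi>\<^sub>i \<mu>\<^sub>i)\<close> for \<open>i \<le> j\<close> and \<open>0\<close> for \<open>i > j\<close>. Therefore \<open>\<mu>\<^sub>i \<Delta>g(i)\<close> is \<open>\<pi>\<^sub>j / \<pi>\<^sub>i\<close> for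
  \<open>i \<le> j\<close>, while detailed balance \<open>\<lambda>\<^sub>i \<pi>\<^sub>i = \<mu>\<^bsub>i+1\<^esub> \<pi>\<^bsub>i+1\<^esub>\<close> makes \<open>\<lambda>\<^sub>i \<Delta>g(i + 1)\<close> equal to the same
  ratio \<open>\<pi>\<^sub>j / \<pi>\<^sub>i\<close>, but only for \<open>i < j\<close>. The difference is the \<open>j\<close>-th unit vector
  (\<open>generator_green_entry\<close>). This gives a right inverse, and a right inverse of a square matrix over
  a field is a left inverse.
\<close>

text \<open>
  The Green function of the chain killed at \<open>0\<close>: for \<open>p\<close> the stationary law, the mean time spent
  in \<open>j\<close> before reaching \<open>0\<close> from \<open>i\<close>. The row index \<open>0\<close> is admitted, and supplies the boundary
  value \<open>0\<close>.
\<close>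

definition green_entry :: "(nat \<Rightarrow> real) \<Rightarrow> (nat \<Rightarrow> real) \<Rightarrow> nat \<Rightarrow> nat \<Rightarrow> real" where
  "green_entry p mu i j = (\<Sum>k=1..min i j. p j / (p k * mu k))"

lemma green_entry_0 [simp]: "green_entry p mu 0 j = 0"
  by (simp add: green_entry_def)

lemma green_entry_Suc:
  "green_entry p mu (Suc i) j - green_entry p mu i j =
     (if Suc i \<le> j then p j / (p (Suc i) * mu (Suc i)) else 0)"
  by (cases "Suc i \<le> j") (auto simp: green_entry_def min_absorb1 min_absorb2)

lemma rate_prod_pos:
  assumes "\<And>k. k < i \<Longrightarrow> lam k > 0" and "\<And>k. 1 \<le> k \<Longrightarrow> k \<le> i \<Longrightarrow> mu k > 0"
  shows "rate_prod lam mu i > 0"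
  unfolding rate_prod_def using assms by (intro prod_pos ballI divide_pos_pos) auto

lemma stat_prob_pos:
  assumes "\<And>k. k < J \<Longrightarrow> lam k > 0" and "\<And>k. 1 \<le> k \<Longrightarrow> k \<le> J \<Longrightarrow> mu k > 0" and "i \<le> J"
  shows "stat_prob J lam mu i > 0"
proof -
  have "rate_prod lam mu j > 0" if "j \<le> J" for j
    using that assms by (intro rate_prod_pos) auto
  then show ?thesis
    unfolding stat_prob_def using assms(3) by (intro divide_pos_pos sum_pos) auto
qed

lemma detailed_balance:
  assumes "mu (Suc i) \<noteq> 0"
  shows "lam i * stat_prob J lam mu i = mu (Suc i) * stat_prob J lam mu (Suc i)"
  using assms by (simp add: stat_prob_def rate_prod_def)

lemma tridiag_row_sum:
  assumes "1 \<le> i" "i \<le> J" "lam J = 0" "g 0 = 0"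
  shows "(\<Sum>j=1..J. tridiag_entry lam mu i j * g j) =
    mu i * (g i - g (i - 1)) - lam i * (g (Suc i) - g i)"
proof -
  have "(\<Sum>j=1..J. tridiag_entry lam mu i j * g j) =
     (\<Sum>j=1..J. (if j = i then (lam i + mu i) * g i else 0)
        - (if j = Suc i then lam i * g (Suc i) else 0)
        - (if j = i - 1 then mu i * g (i - 1) else 0))"
    using assms(1) by (intro sum.cong refl) (auto simp: tridiag_entry_def)
  also have "\<dots> = (lam i + mu i) * g i
        - (if Suc i \<le> J then lam i * g (Suc i) else 0)
        - (if 1 \<le> i - 1 then mu i * g (i - 1) else 0)"
    using assms(1,2) by (auto simp: sum_subtractf)
  also have "(if Suc i \<le> J then lam i * g (Suc i) else 0) = lam i * g (Suc i)"
    using assms(2,3) by (cases "i = J") auto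
  also have "(if 1 \<le> i - 1 then mu i * g (i - 1) else 0) = mu i * g (i - 1)"
    using assms(4) by (cases "i - 1") auto
  finally show ?thesis by (simp add: algebra_simps)
qed

text \<open>
  Detailed balance turns \<open>\<lambda>\<^sub>i p\<^sub>j / (p\<^bsub>i+1\<^esub> \<mu>\<^bsub>i+1\<^esub>)\<close> into \<open>p\<^sub>j / p\<^sub>i\<close>, so the two
  terms cancel for \<open>i < j\<close>, only the first survives for \<open>i = j\<close>, and both vanish for \<open>i > j\<close>.
  The two hypotheses about \<open>Suc i\<close> are restricted to \<open>i < j\<close> because at \<open>i = j\<close> the index
  \<open>Suc i\<close> may lie outside the state space.
\<close>

lemma generator_green_entry:
  assumes "p i \<noteq> 0" "mu i \<noteq> 0" "1 \<le> i"
    and balance: "i < j \<Longrightarrow> lam i * p i = mu (Suc i) * p (Suc i)"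
    and nonzero: "i < j \<Longrightarrow> mu (Suc i) * p (Suc i) \<noteq> 0"
  shows "mu i * (green_entry p mu i j - green_entry p mu (i - 1) j)
       - lam i * (green_entry p mu (Suc i) j - green_entry p mu i j) = (if i = j then 1 else 0)"
proof -
  have "mu i * (green_entry p mu i j - green_entry p mu (i - 1) j) = (if i \<le> j then p j / p i else 0)"
    using green_entry_Suc[of p mu "i - 1" j] assms(1-3) by simp
  moreover have "lam i * (p j / (p (Suc i) * mu (Suc i))) = p j / p i" if "i < j"
    using balance[OF that] nonzero[OF that] assms(1) by (simp add: field_simps)
  then have "lam i * (green_entry p mu (Suc i) j - green_entry p mu i j) =
      (if i < j then p j / p i else 0)"
    unfolding green_entry_Suc by auto
  ultimately show ?thesis using assms(1) by auto
qed

theorem lemma1: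
  fixes J :: nat and lam mu :: "nat \<Rightarrow> real"
  assumes "J > 0"
    and "\<And>i. i < J \<Longrightarrow> lam i > 0"
    and "\<And>i. 1 \<le> i \<Longrightarrow> i \<le> J \<Longrightarrow> mu i > 0"
    and "lam J = 0"
  shows "invertible_mat (W_mat J lam mu) \<and>
    (\<exists>V \<in> carrier_mat J J.
       inverts_mat (W_mat J lam mu) V \<and> inverts_mat V (W_mat J lam mu) \<and>
       (\<forall>i \<in> {1..J}. \<forall>j \<in> {1..J}.
          V $$ (i - 1, j - 1) =
            (\<Sum>k=1..min i j. stat_prob J lam mu j / (stat_prob J lam mu k * mu k))))"
proof -
  define p where "p = stat_prob J lam mu"
  define V where "V = mat J J (\<lambda>(a, b). green_entry p mu (Suc a) (Suc b))"
  have W: "W_mat J lam mu \<in> carrier_mat J J" and V: "V \<in> carrier_mat J J"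
    by (auto simp: W_mat_def V_def)
  have p: "p i \<noteq> 0" if "i \<le> J" for i
    using stat_prob_pos[of J lam mu i] assms(2,3) that by (simp add: p_def)
  have mu: "mu i \<noteq> 0" if "1 \<le> i" "i \<le> J" for i
    using assms(3)[OF that] by simp
  have entry: "(\<Sum>k=1..J. tridiag_entry lam mu i k * green_entry p mu k j) = (if i = j then 1 else 0)"
    if "1 \<le> i" "i \<le> J" "j \<le> J" for i j
  proof -
    have "lam i * p i = mu (Suc i) * p (Suc i)" "mu (Suc i) * p (Suc i) \<noteq> 0" if "i < j"
      using detailed_balance[of mu i lam J] mu[of "Suc i"] p[of "Suc i"] that \<open>j \<le> J\<close>
      by (auto simp: p_def)
    then show ?thesis
      using generator_green_entry[of p i mu j lam] p[of i] mu[of i] that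
        tridiag_row_sum[of i J lam "\<lambda>k. green_entry p mu k j" mu] assms(4)
      by simp
  qed
  have "W_mat J lam mu * V = 1\<^sub>m J"
  proof (rule eq_matI)
    fix a b assume "a < dim_row (1\<^sub>m J :: real mat)" "b < dim_col (1\<^sub>m J :: real mat)"
    then have ab: "a < J" "b < J" by auto
    have "(W_mat J lam mu * V) $$ (a, b) =
        (\<Sum>c=0..<J. tridiag_entry lam mu (Suc a) (Suc c) * green_entry p mu (Suc c) (Suc b))"
      using ab by (simp add: W_mat_def V_def scalar_prod_def)
    also have "\<dots> = (\<Sum>k=1..J. tridiag_entry lam mu (Suc a) k * green_entry p mu k (Suc b))"
      using sum.shift_bounds_Suc_ivl[of "\<lambda>k. tridiag_entry lam mu (Suc a) k * green_entry p mu k (Suc b)" 0 J]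
      by (simp add: atLeastLessThanSuc_atLeastAtMost)
    finally show "(W_mat J lam mu * V) $$ (a, b) = 1\<^sub>m J $$ (a, b)"
      using entry[of "Suc a" "Suc b"] ab by simp
  qed (use W V in auto)
  moreover from this have "V * W_mat J lam mu = 1\<^sub>m J"
    by (rule mat_mult_left_right_inverse[OF W V])
  ultimately have inv: "inverts_mat (W_mat J lam mu) V" "inverts_mat V (W_mat J lam mu)"
    using W V by (auto simp: inverts_mat_def)
  moreover have "invertible_mat (W_mat J lam mu)"
    using inv W by (auto simp: invertible_mat_def)
  moreover have "V $$ (i - 1, j - 1) =
      (\<Sum>k=1..min i j. stat_prob J lam mu j / (stat_prob J lam mu k * mu k))"
    if "i \<in> {1..J}" "j \<in> {1..J}" for i j
  proof -
    have "V $$ (i - 1, j - 1) = green_entry p mu (Suc (i - 1)) (Suc (j - 1))"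
      using that by (auto simp: V_def)
    also have "\<dots> = green_entry p mu i j"
      using that by simp
    finally show ?thesis
      unfolding green_entry_def p_def .
  qed
  ultimately show ?thesis using V by blast
qed

end
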